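(* For a step set $X\subseteq\mathbb{Z}^2\setminus\{O\}$ and a submonoid $\mathcal{C}$ of $\mathbb{Z}^2$, consider the following statements: (i) $(X,\mathcal{C})$ has the Infinite Paths Property (IPP); (ii) $O\in\operatorname{Conv}(X)$; (iii) $O\in\operatorname{Conv}(\mathcal{A}_X^{\mathcal{C}}\setminus\{O\})$; (iv) $\mathcal{A}_X^{\mathcal{C}}$ has non-trivial units (i.e. an invertible element other than $O$). Then the implications that hold among (i)–(iv) (for all such $X$ and $\mathcal{C}$) are precisely those inferrable from $$\text{(iii)}\iff\text{(iv)}\implies\text{(i)}\implies\text{(ii)}.$$ That is, these implications hold for all step sets $X$ and submonoids $\mathcal{C}$, while none of the implications (i)$\Rightarrow$(iii), (i)$\Rightarrow$(iv), (ii)$\Rightarrow$(i), (ii)$\Rightarrow$(iii), (ii)$\Rightarrow$(iv) holds for all step sets $X$ and submonoids $\mathcal{C}$.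
   Context: Write $O=(0,0)$. A step set is any (finite or infinite) subset $X$ of $\mathbb{Z}^2\setminus\{O\}$. $\mathcal{F}_X$ is the free monoid on $X$ (all finite words over $X$, including the empty word), with $\ell(w)$ the length of $w$; for $w=A_1\cdots A_k\in\mathcal{F}_X$ put $\alpha_X(w)=A_1+\cdots+A_k$ and, for $0\le m\le k$, $\sigma_m(w)=A_1\cdots A_m$. For a submonoid $\mathcal{C}$ of $\mathbb{Z}^2$, define $\mathcal{F}_X^{\mathcal{C}}=\{w\in\mathcal{F}_X:\alpha_X(\sigma_m(w))\in\mathcal{C}\text{ for all }0\le m\le\ell(w)\}$ and $\mathcal{A}_X^{\mathcal{C}}=\alpha_X(\mathcal{F}_X^{\mathcal{C}})$; these are submonoids of $\mathcal{F}_X$ and $\mathbb{Z}^2$ respectively. For $A\in\mathbb{Z}^2$, $\pi_X^{\mathcal{C}}(A)$ is the (possibly infinite) number of $w\in\mathcal{F}_X^{\mathcal{C}}$ with $\alpha_X(w)=A$. $(X,\mathcal{C})$ has the IPP if $\pi_X^{\mathcal{C}}(A)=\infty$ for all $A\in\mathcal{A}_X^{\mathcal{C}}$. $\operatorname{Conv}$ denotes convex hull in $\mathbb{R}^2$. *)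

theory Defs
  imports "HOL-Analysis.Analysis"
begin

text \<open>The lattice \<open>\<int>\<^sup>2\<close> is the type \<^typ>\<open>int \<times> int\<close> with componentwise addition, and the origin
  \<open>O\<close> is \<^term>\<open>0 :: int \<times> int\<close>. Words over \<open>X\<close> are the elements of \<^term>\<open>lists X\<close>.\<close>

definition step_set :: "(int \<times> int) set \<Rightarrow> bool" where
  "step_set X \<longleftrightarrow> 0 \<notin> X"

definition is_submonoid :: "(int \<times> int) set \<Rightarrow> bool" where
  "is_submonoid C \<longleftrightarrow> 0 \<in> C \<and> (\<forall>a\<in>C. \<forall>b\<in>C. a + b \<in> C)"

text \<open>\<open>\<alpha>\<^sub>X\<close>; the formula does not depend on \<open>X\<close>, only its domain \<^term>\<open>lists X\<close> does.\<close>

definition endpoint :: "(int \<times> int) list \<Rightarrow> int \<times> int" where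
  "endpoint w = sum_list w"

definition constrained_words :: "(int \<times> int) set \<Rightarrow> (int \<times> int) set \<Rightarrow> (int \<times> int) list set" where
  "constrained_words X C = {w \<in> lists X. \<forall>m \<le> length w. endpoint (take m w) \<in> C}"

definition constrained_monoid :: "(int \<times> int) set \<Rightarrow> (int \<times> int) set \<Rightarrow> (int \<times> int) set" where
  "constrained_monoid X C = endpoint ` constrained_words X C"

definition num_words :: "(int \<times> int) set \<Rightarrow> (int \<times> int) set \<Rightarrow> int \<times> int \<Rightarrow> enat" where
  "num_words X C A =
     (let W = {w \<in> constrained_words X C. endpoint w = A}
      in if finite W then enat (card W) else \<infinity>)"

definition IPP :: "(int \<times> int) set \<Rightarrow> (int \<times> int) set \<Rightarrow> bool" where
  "IPP X C \<longleftrightarrow> (\<forall>A \<in> constrained_monoid X C. num_words X C A = \<infinity>)"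

definition Conv :: "(int \<times> int) set \<Rightarrow> (real \<times> real) set" where
  "Conv S = convex hull ((\<lambda>(a, b). (real_of_int a, real_of_int b)) ` S)"

definition has_nontrivial_units :: "(int \<times> int) set \<Rightarrow> bool" where
  "has_nontrivial_units M \<longleftrightarrow> (\<exists>u\<in>M. u \<noteq> 0 \<and> (\<exists>v\<in>M. u + v = 0))"

end

theory Submission
  imports Defs
begin

text \<open>A convex combination of lattice points equal to \<open>O\<close> can be taken with at most three points by
  Caratheodory's theorem, and two-by-two determinants (or inner products, when the points are
  collinear) turn the real weights into integer ones; this gives \<open>(iii) \<Longrightarrow> (iv)\<close>. A non-trivial
  unit closes up to a non-empty loop at \<open>O\<close>, which can be prepended to any path arbitrarily often;
  conversely, IPP at \<open>O\<close> yields a non-empty loop, whose steps average to \<open>O\<close>. For the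
  counterexamples take the two steps \<open>(1,0)\<close> and \<open>(-1,0)\<close>, constrained to the first quadrant or
  to \<open>{O}\<close>.\<close>

section \<open>Convex relations between lattice points and non-trivial units\<close>

definition scale :: "int \<Rightarrow> int \<times> int \<Rightarrow> int \<times> int" where
  "scale k p = (k * fst p, k * snd p)"

lemma fst_scale [simp]: "fst (scale k p) = k * fst p"
  and snd_scale [simp]: "snd (scale k p) = k * snd p"
  by (simp_all add: scale_def)

lemma scale_in_submonoid:
  assumes "is_submonoid M" "p \<in> M" "0 \<le> k"
  shows "scale k p \<in> M"
  using assms(3)
proof (induction k rule: int_ge_induct)
  case base
  then show ?case using assms by (simp add: scale_def is_submonoid_def zero_prod_def)
next
  case (step k)
  have "scale (k + 1) p = scale k p + p"
    by (auto simp: prod_eq_iff algebra_simps)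
  then show ?case using step assms by (simp add: is_submonoid_def)
qed

text \<open>The unit is \<open>scale k A\<close>, with inverse \<open>scale l B\<close>;
  \<open>0 < k\<close> and \<open>A \<noteq> 0\<close> keep it away from O.\<close>

lemma units_of_two:
  assumes "is_submonoid M" "A \<in> M" "B \<in> M" "A \<noteq> 0"
    and "0 < k" "0 \<le> l" "scale k A + scale l B = 0"
  shows "has_nontrivial_units M"
proof -
  have "scale k A \<noteq> 0"
    using assms by (auto simp: prod_eq_iff)
  moreover have "scale k A \<in> M" "scale l B \<in> M"
    using assms by (auto intro: scale_in_submonoid)
  ultimately show ?thesis
    using assms unfolding has_nontrivial_units_def by blast
qed

text \<open>\<open>B\<close> lies on the line through \<open>A\<close>, so it equals its orthogonal
  projection onto it; clearing the denominator \<open>|A|^2\<close> gives an integer relation, whose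
  coefficients are positive as \<open>B\<close> points against \<open>A\<close>.\<close>

lemma units_of_antiparallel:
  assumes M: "is_submonoid M" "A \<in> M" "B \<in> M"
    and det: "fst A * snd B = snd A * fst B"
    and neg: "fst A * fst B + snd A * snd B < 0"
  shows "has_nontrivial_units M"
proof (rule units_of_two[OF M])
  show "A \<noteq> 0" using neg by auto
  show "0 < - (fst A * fst B + snd A * snd B)" using neg by simp
  show "0 \<le> fst A * fst A + snd A * snd A" by simp
  show "scale (- (fst A * fst B + snd A * snd B)) A + scale (fst A * fst A + snd A * snd A) B = 0"
    using det by (simp add: prod_eq_iff) algebra
qed

text \<open>Cramer's rule in the plane: \<open>[B,D] A + [D,A] B + [A,B] D = 0\<close>. The last two
  terms together form one element of \<open>M\<close>, leaving a relation between two
  elements.\<close>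

lemma units_of_positive_determinants:
  assumes M: "is_submonoid M" "A \<in> M" "B \<in> M" "D \<in> M"
    and "A \<noteq> 0"
    and "0 < fst B * snd D - snd B * fst D"
    and "0 \<le> fst D * snd A - snd D * fst A"
    and "0 \<le> fst A * snd B - snd A * fst B"
  shows "has_nontrivial_units M"
proof (rule units_of_two[OF M(1,2) _ \<open>A \<noteq> 0\<close>, where l = 1])
  let ?P = "scale (fst D * snd A - snd D * fst A) B + scale (fst A * snd B - snd A * fst B) D"
  show "?P \<in> M"
    using M assms(7,8) scale_in_submonoid unfolding is_submonoid_def by blast
  show "scale (fst B * snd D - snd B * fst D) A + scale 1 ?P = 0"
    by (simp add: prod_eq_iff algebra_simps)
qed (use assms in auto)

text \<open>The weights are proportional to the determinants \<open>[B,D]\<close>, \<open>[D,A]\<close>, \<open>[A,B]\<close>.\<close>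

lemma units_of_three:
  fixes u v w :: real
  assumes M: "is_submonoid M" "A \<in> M" "B \<in> M" "D \<in> M"
    and nz: "A \<noteq> 0"
    and pos: "0 < u" "0 \<le> v" "0 \<le> w"
    and x: "u * fst A + v * fst B + w * fst D = 0"
    and y: "u * snd A + v * snd B + w * snd D = 0"
  shows "has_nontrivial_units M"
proof -
  define a where "a = fst B * snd D - snd B * fst D"
  define b where "b = fst D * snd A - snd D * fst A"
  define d where "d = fst A * snd B - snd A * fst B"
  \<comment> \<open>Determinants of the relation with \<open>D\<close>, and below with
    \<open>B\<close>, eliminate one term each. Hence \<open>b\<close> and \<open>d\<close> vanish or
    share the sign of \<open>a\<close>.\<close>
  have ub: "u * b = v * a"
    unfolding a_def b_def using x y by simp algebra
  have ud: "u * d = w * a"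
    unfolding a_def d_def using x y by simp algebra
  have b: "real_of_int b = v / u * a" and d: "real_of_int d = w / u * a"
    using ub ud pos by (simp_all add: field_simps)
  consider "a > 0" | "a < 0" | "a = 0" by linarith
  then show ?thesis
  proof cases
    case 1
    then have "real_of_int b \<ge> 0" "real_of_int d \<ge> 0"
      unfolding b d using pos by auto
    then have "b \<ge> 0" "d \<ge> 0" by simp_all
    then show ?thesis
      using units_of_positive_determinants[OF M nz] 1 by (simp add: a_def b_def d_def)
  next
    \<comment> \<open>Exchanging \<open>B\<close> and \<open>D\<close> flips the sign of all three
      determinants.\<close>
    case 2
    then have "real_of_int b \<le> 0" "real_of_int d \<le> 0"
      unfolding b d using pos by (simp_all add: mult_nonneg_nonpos divide_nonpos_pos)
    then have "b \<le> 0" "d \<le> 0" by simp_all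
    then show ?thesis
      using units_of_positive_determinants[OF M(1,2,4,3) nz] 2
      by (simp add: a_def b_def d_def algebra_simps)
  next
    \<comment> \<open>Now \<open>B\<close> and \<open>D\<close> lie on the line through
      \<open>A\<close>. The inner product of the relation with \<open>A\<close> has a positive first
      term, so \<open>B\<close> or \<open>D\<close> points against \<open>A\<close>.\<close>
    case 3
    then have "real_of_int b = 0" "real_of_int d = 0"
      unfolding b d by auto
    then have bd: "b = 0" "d = 0" by auto
    define AA where "AA = fst A * fst A + snd A * snd A"
    define AB where "AB = fst A * fst B + snd A * snd B"
    define AD where "AD = fst A * fst D + snd A * snd D"
    have "AA > 0"
      using nz unfolding AA_def by (auto simp: prod_eq_iff sum_squares_gt_zero_iff)
    moreover have "u * AA + v * AB + w * AD = 0"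
      unfolding AA_def AB_def AD_def using x y by simp algebra
    ultimately have "v * AB + w * AD < 0"
      using pos by (smt (verit) mult_pos_pos of_int_pos)
    then have "AB < 0 \<or> AD < 0"
      using pos by (smt (verit) mult_nonneg_nonneg of_int_nonneg)
    then show ?thesis
    proof
      assume "AB < 0"
      then show ?thesis
        using units_of_antiparallel[OF M(1,2,3)] bd by (simp add: AB_def d_def)
    next
      assume "AD < 0"
      then show ?thesis
        using units_of_antiparallel[OF M(1,2,4)] bd by (simp add: AD_def b_def algebra_simps)
    qed
  qed
qed

text \<open>The three names may coincide, which covers the smaller cardinalities; \<open>x\<close>
  excludes the empty set.\<close>

lemma card_le_three_imp_triple:
  assumes "finite S" "card S \<le> 3" "x \<in> S"
  obtains a b c where "S = {a, b, c}"
proof -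
  have "card S = 1 \<or> card S = 2 \<or> card S = 3"
    using assms by (cases "card S") auto
  then show ?thesis
    using that by (auto simp: card_1_singleton_iff card_2_iff card_3_iff)
qed

lemma units_of_zero_in_Conv:
  assumes M: "is_submonoid M" and "0 \<in> Conv (M - {0})"
  shows "has_nontrivial_units M"
proof -
  let ?r = "\<lambda>(a, b). (real_of_int a, real_of_int b)"
  obtain S where S: "finite S" "S \<subseteq> ?r ` (M - {0})" "card S \<le> DIM(real \<times> real) + 1"
    "0 \<in> convex hull S"
    using assms(2) unfolding Conv_def caratheodory[of "?r ` (M - {0})"] by auto
  obtain z where "z \<in> S" using S(4) by (cases "S = {}") auto
  then obtain p q r where Seq: "S = {p, q, r}"
    using card_le_three_imp_triple[of S z] S(1,3) by (simp add: numeral_3_eq_3) blast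
  then obtain A B D where ABD: "A \<in> M - {0}" "B \<in> M - {0}" "D \<in> M - {0}"
    and pqr: "p = ?r A" "q = ?r B" "r = ?r D"
    using S(2) unfolding Seq insert_subset by (elim conjE imageE) blast
  obtain u v w where uvw: "0 \<le> u" "0 \<le> v" "0 \<le> w" "u + v + w = 1"
    and e: "0 = u *\<^sub>R p + v *\<^sub>R q + w *\<^sub>R r"
    using S(4) unfolding Seq convex_hull_3 by auto
  have x: "u * fst A + v * fst B + w * fst D = 0"
    using arg_cong[OF e, of fst] by (simp add: pqr split_beta)
  have y: "u * snd A + v * snd B + w * snd D = 0"
    using arg_cong[OF e, of snd] by (simp add: pqr split_beta)
  \<comment> \<open>The weights sum to 1, so one is positive; its point is moved to the front, where
    \<open>units_of_three\<close> wants a positive weight.\<close>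
  consider "u > 0" | "v > 0" | "w > 0" using uvw by linarith
  then show ?thesis
  proof cases
    case 1
    then show ?thesis using units_of_three[of M A B D u v w] M ABD uvw x y by auto
  next
    case 2
    then show ?thesis using units_of_three[of M B A D v u w] M ABD uvw x y by auto
  next
    case 3
    then show ?thesis using units_of_three[of M D A B w u v] M ABD uvw x y by auto
  qed
qed

text \<open>O is the midpoint of a unit and its inverse, both non-zero.\<close>

lemma zero_in_Conv_of_units:
  assumes "has_nontrivial_units M"
  shows "0 \<in> Conv (M - {0})"
proof -
  let ?r = "\<lambda>(a, b). (real_of_int a, real_of_int b)"
  obtain u v where uv: "u \<in> M" "v \<in> M" "u \<noteq> 0" "u + v = 0"
    using assms unfolding has_nontrivial_units_def by auto
  have v: "v = - u" using uv(4) by (simp add: eq_neg_iff_add_eq_0 add.commute)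
  have "(1/2) *\<^sub>R ?r u + (1/2) *\<^sub>R ?r v \<in> convex hull (?r ` (M - {0}))"
    using uv v by (intro convexD[OF convex_convex_hull] hull_inc imageI) auto
  moreover have "(1/2) *\<^sub>R ?r u + (1/2) *\<^sub>R ?r v = 0"
    by (simp add: v prod_eq_iff split_beta)
  ultimately show ?thesis unfolding Conv_def by simp
qed

section \<open>Constrained words, loops at the origin and IPP\<close>

lemma constrained_words_append:
  assumes "is_submonoid C" "w \<in> constrained_words X C" "z \<in> constrained_words X C"
  shows "w @ z \<in> constrained_words X C"
proof -
  have "endpoint (take m (w @ z)) \<in> C" if "m \<le> length (w @ z)" for m
  proof -
    \<comment> \<open>A prefix of \<open>w @ z\<close> splits into a prefix of \<open>w\<close> and
      one of \<open>z\<close>. The \<open>min\<close> keeps the index within \<open>w\<close>; the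
      truncated subtraction gives the empty prefix of \<open>z\<close> while \<open>m\<close> is
      still inside \<open>w\<close>.\<close>
    have "endpoint (take (min m (length w)) w) \<in> C" "endpoint (take (m - length w) z) \<in> C"
      using assms(2,3) that by (auto simp: constrained_words_def)
    then have "endpoint (take m w) + endpoint (take (m - length w) z) \<in> C"
      using assms(1) by (simp add: is_submonoid_def min_def split: if_splits)
    then show ?thesis by (simp add: endpoint_def)
  qed
  then show ?thesis using assms(2,3) by (simp add: constrained_words_def)
qed

lemma Nil_in_constrained_words: "is_submonoid C \<Longrightarrow> [] \<in> constrained_words X C"
  by (simp add: constrained_words_def endpoint_def is_submonoid_def)

lemma is_submonoid_constrained_monoid:
  assumes "is_submonoid C"
  shows "is_submonoid (constrained_monoid X C)"
  unfolding is_submonoid_def constrained_monoid_def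
proof (intro conjI ballI)
  show "0 \<in> endpoint ` constrained_words X C"
    using Nil_in_constrained_words[OF assms] by (force simp: endpoint_def)
next
  fix a b
  assume "a \<in> endpoint ` constrained_words X C" "b \<in> endpoint ` constrained_words X C"
  then obtain w z where "w \<in> constrained_words X C" "z \<in> constrained_words X C"
    "a = endpoint w" "b = endpoint z" by auto
  then show "a + b \<in> endpoint ` constrained_words X C"
    using constrained_words_append[OF assms] by (intro image_eqI[of _ _ "w @ z"]) (auto simp: endpoint_def)
qed

lemma constrained_monoid_subset: "constrained_monoid X C \<subseteq> C"
  by (force simp: constrained_monoid_def constrained_words_def)

lemma IPP_of_loop:
  assumes C: "is_submonoid C" and w: "w \<in> constrained_words X C" "w \<noteq> []" "endpoint w = 0"
  shows "IPP X C"
  unfolding IPP_def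
proof
  fix A assume "A \<in> constrained_monoid X C"
  then obtain z where z: "z \<in> constrained_words X C" "endpoint z = A"
    by (auto simp: constrained_monoid_def)
  \<comment> \<open>\<open>f n\<close> is \<open>z\<close> preceded by \<open>n\<close> copies of
    the loop; as \<open>w\<close> is non-empty, the lengths separate these words.\<close>
  define f where "f n = ((@) w ^^ n) z" for n
  let ?W = "{w \<in> constrained_words X C. endpoint w = A}"
  have f: "f n \<in> ?W" for n
  proof (induction n)
    case (Suc n)
    then show ?case
      using constrained_words_append[OF C w(1)] w(3) by (simp add: f_def endpoint_def)
  qed (simp add: f_def z)
  have "strict_mono (\<lambda>n. length (f n))"
    using w(2) by (simp add: strict_mono_Suc_iff f_def)
  then have "inj f"
    using strict_mono_imp_inj_on inj_on_imageI2[of length f UNIV] by (auto simp: comp_def)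
  then have "infinite ?W"
    using f by (metis (no_types, lifting) image_subsetI infinite_iff_countable_subset)
  then show "num_words X C A = \<infinity>" by (simp add: num_words_def)
qed

text \<open>The empty word reaches O, so IPP applies there, and infinitely many words cannot all be
  empty.\<close>

lemma loop_of_IPP:
  assumes "is_submonoid C" "IPP X C"
  obtains w where "w \<in> constrained_words X C" "w \<noteq> []" "endpoint w = 0"
proof -
  let ?W = "{w \<in> constrained_words X C. endpoint w = 0}"
  have "num_words X C 0 = \<infinity>"
    using assms is_submonoid_constrained_monoid by (auto simp: IPP_def is_submonoid_def)
  then have "infinite ?W"
    by (auto simp: num_words_def Let_def split: if_splits)
  then have "\<not> ?W \<subseteq> {[]}" using finite_subset by blast
  then show ?thesis using that by auto
qed

lemma IPP_of_units:
  assumes "is_submonoid C" "has_nontrivial_units (constrained_monoid X C)"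
  shows "IPP X C"
proof -
  obtain w z where wz: "w \<in> constrained_words X C" "z \<in> constrained_words X C"
    "endpoint w \<noteq> 0" "endpoint w + endpoint z = 0"
    using assms(2) by (auto simp: has_nontrivial_units_def constrained_monoid_def)
  show ?thesis
  proof (rule IPP_of_loop[OF assms(1)])
    show "w @ z \<in> constrained_words X C" using constrained_words_append[OF assms(1)] wz by blast
    \<comment> \<open>The unit \<open>endpoint w\<close> is not O, so \<open>w\<close> itself is
      non-empty.\<close>
    show "w @ z \<noteq> []" using wz(3) by (auto simp: endpoint_def)
    show "endpoint (w @ z) = 0" using wz(4) by (simp add: endpoint_def)
  qed
qed

text \<open>The combination runs over positions with equal weights, so repeated entries are counted
  with multiplicity.\<close>

lemma average_in_convex_hull:
  fixes f :: "'a \<Rightarrow> 'b::real_vector"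
  assumes "xs \<noteq> []" "set xs \<subseteq> X"
  shows "(1 / length xs) *\<^sub>R sum_list (map f xs) \<in> convex hull (f ` X)"
proof -
  have "(\<Sum>i<length xs. (1 / length xs) *\<^sub>R f (xs ! i)) \<in> convex hull (f ` X)"
    using assms
    by (intro convex_sum convex_convex_hull hull_inc imageI) (auto simp: subset_iff)
  then show ?thesis
    by (simp add: sum_list_sum_nth atLeast0LessThan scaleR_sum_right)
qed

lemma zero_in_Conv_of_IPP:
  assumes "is_submonoid C" "IPP X C"
  shows "0 \<in> Conv X"
proof -
  let ?r = "\<lambda>(a, b). (real_of_int a, real_of_int b)"
  obtain w where w: "w \<in> constrained_words X C" "w \<noteq> []" "endpoint w = 0"
    using loop_of_IPP[OF assms] .
  \<comment> \<open>The embedding into the real plane is additive, so the steps of the loop still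
    sum to the origin, and so does their average.\<close>
  have "sum_list (map ?r xs) = ?r (sum_list xs)" for xs
    by (induction xs) (auto simp: prod_eq_iff split_beta)
  then have "sum_list (map ?r w) = 0"
    using w(3) by (simp add: endpoint_def zero_prod_def)
  then show ?thesis
    using average_in_convex_hull[of w X ?r] w by (auto simp: Conv_def constrained_words_def)
qed

section \<open>Counterexamples to the remaining implications\<close>

definition horizontal_steps :: "(int \<times> int) set" where
  "horizontal_steps = {(1, 0), (- 1, 0)}"

definition quadrant :: "(int \<times> int) set" where
  "quadrant = {(a, b). 0 \<le> a \<and> 0 \<le> b}"

lemma step_set_horizontal_steps: "step_set horizontal_steps"
  by (simp add: step_set_def horizontal_steps_def zero_prod_def)

lemma is_submonoid_quadrant: "is_submonoid quadrant"
  by (auto simp: is_submonoid_def quadrant_def zero_prod_def)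

lemma is_submonoid_zero: "is_submonoid {0}"
  by (simp add: is_submonoid_def)

lemma IPP_quadrant: "IPP horizontal_steps quadrant"
proof (rule IPP_of_loop[OF is_submonoid_quadrant])
  \<comment> \<open>The order matters: stepping right first keeps the loop inside the
    quadrant.\<close>
  let ?w = "[(1, 0), (- 1, 0)] :: (int \<times> int) list"
  have "endpoint (take m ?w) \<in> quadrant" for m
  proof -
    have "m = 0 \<or> m = 1 \<or> m \<ge> 2" by linarith
    then show ?thesis by (auto simp: endpoint_def quadrant_def zero_prod_def)
  qed
  then show "?w \<in> constrained_words horizontal_steps quadrant"
    by (simp add: constrained_words_def horizontal_steps_def)
  show "endpoint ?w = 0" by (simp add: endpoint_def zero_prod_def)
qed simp

text \<open>The constrained monoid lies in \<open>C\<close>, so its units are units of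
  \<open>C\<close>.\<close>

lemma no_units_subset:
  assumes "\<And>u v. u \<in> C \<Longrightarrow> v \<in> C \<Longrightarrow> u + v = 0 \<Longrightarrow> u = 0"
  shows "\<not> has_nontrivial_units (constrained_monoid X C)"
  using assms constrained_monoid_subset[of X C] unfolding has_nontrivial_units_def by blast

lemma no_units_quadrant: "\<not> has_nontrivial_units (constrained_monoid X quadrant)"
  by (rule no_units_subset) (auto simp: quadrant_def prod_eq_iff)

lemma no_units_zero: "\<not> has_nontrivial_units (constrained_monoid X {0})"
  by (rule no_units_subset) auto

text \<open>The hull of the steps ignores the constraint, so IPP in the quadrant also settles (ii)
  for the constraint \<open>{0}\<close>.\<close>

lemma zero_in_Conv_horizontal_steps: "0 \<in> Conv horizontal_steps"
  using zero_in_Conv_of_IPP[OF is_submonoid_quadrant IPP_quadrant] .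

text \<open>The first step of a non-empty word would have to be O, which a step set
  excludes.\<close>

lemma not_IPP_zero:
  assumes "step_set X"
  shows "\<not> IPP X {0}"
proof
  assume "IPP X {0}"
  then obtain w where w: "w \<in> constrained_words X {0}" "w \<noteq> []"
    using loop_of_IPP[OF is_submonoid_zero] by blast
  then obtain a z where wz: "w = a # z" by (cases w) auto
  have "endpoint (take 1 w) = 0"
    using w wz by (auto simp: constrained_words_def)
  then show False
    using w wz assms by (auto simp: endpoint_def constrained_words_def step_set_def)
qed

section \<open>The implications and their failures together\<close>

lemma zero_in_Conv_iff_units:
  assumes "is_submonoid C"
  shows "0 \<in> Conv (constrained_monoid X C - {0})
    \<longleftrightarrow> has_nontrivial_units (constrained_monoid X C)"
  using units_of_zero_in_Conv zero_in_Conv_of_units is_submonoid_constrained_monoid[OF assms]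
  by blast

theorem proposition3p10:
  shows
    "(\<forall>X C. step_set X \<longrightarrow> is_submonoid C \<longrightarrow>
        (0 \<in> Conv (constrained_monoid X C - {0}) \<longleftrightarrow> has_nontrivial_units (constrained_monoid X C))
      \<and> (has_nontrivial_units (constrained_monoid X C) \<longrightarrow> IPP X C)
      \<and> (IPP X C \<longrightarrow> 0 \<in> Conv X))
   \<and> \<not> (\<forall>X C. step_set X \<longrightarrow> is_submonoid C \<longrightarrow>
        (IPP X C \<longrightarrow> 0 \<in> Conv (constrained_monoid X C - {0})))
   \<and> \<not> (\<forall>X C. step_set X \<longrightarrow> is_submonoid C \<longrightarrow>
        (IPP X C \<longrightarrow> has_nontrivial_units (constrained_monoid X C)))
   \<and> \<not> (\<forall>X C. step_set X \<longrightarrow> is_submonoid C \<longrightarrow>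
        (0 \<in> Conv X \<longrightarrow> IPP X C))
   \<and> \<not> (\<forall>X C. step_set X \<longrightarrow> is_submonoid C \<longrightarrow>
        (0 \<in> Conv X \<longrightarrow> 0 \<in> Conv (constrained_monoid X C - {0})))
   \<and> \<not> (\<forall>X C. step_set X \<longrightarrow> is_submonoid C \<longrightarrow>
        (0 \<in> Conv X \<longrightarrow> has_nontrivial_units (constrained_monoid X C)))"
proof (intro conjI)
  show "\<forall>X C. step_set X \<longrightarrow> is_submonoid C \<longrightarrow>
        (0 \<in> Conv (constrained_monoid X C - {0}) \<longleftrightarrow> has_nontrivial_units (constrained_monoid X C))
      \<and> (has_nontrivial_units (constrained_monoid X C) \<longrightarrow> IPP X C)
      \<and> (IPP X C \<longrightarrow> 0 \<in> Conv X)"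
    using zero_in_Conv_iff_units IPP_of_units zero_in_Conv_of_IPP by blast
  \<comment> \<open>The quadrant admits a loop but has no non-trivial units, refuting the
    implications from (i); the constraint \<open>{0}\<close> destroys every loop while (ii)
    survives, refuting those from (ii).\<close>
  note quadrant = step_set_horizontal_steps is_submonoid_quadrant IPP_quadrant no_units_quadrant
  note zero = step_set_horizontal_steps is_submonoid_zero zero_in_Conv_horizontal_steps
    no_units_zero not_IPP_zero
  show "\<not> (\<forall>X C. step_set X \<longrightarrow> is_submonoid C \<longrightarrow>
        (IPP X C \<longrightarrow> 0 \<in> Conv (constrained_monoid X C - {0})))"
    using quadrant zero_in_Conv_iff_units by blast
  show "\<not> (\<forall>X C. step_set X \<longrightarrow> is_submonoid C \<longrightarrow>
        (IPP X C \<longrightarrow> has_nontrivial_units (constrained_monoid X C)))"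
    using quadrant by blast
  show "\<not> (\<forall>X C. step_set X \<longrightarrow> is_submonoid C \<longrightarrow> (0 \<in> Conv X \<longrightarrow> IPP X C))"
    using zero by blast
  show "\<not> (\<forall>X C. step_set X \<longrightarrow> is_submonoid C \<longrightarrow>
        (0 \<in> Conv X \<longrightarrow> 0 \<in> Conv (constrained_monoid X C - {0})))"
    using zero zero_in_Conv_iff_units by blast
  show "\<not> (\<forall>X C. step_set X \<longrightarrow> is_submonoid C \<longrightarrow>
        (0 \<in> Conv X \<longrightarrow> has_nontrivial_units (constrained_monoid X C)))"
    using zero by blast
qed

end
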